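(* For every integer $n \geq 1$ we have $$\tau(n) \leq 8 \sum_{\substack{d\mid n \\ d\leq n^{1/4}}} \tau(d)^7,$$ where the sum is over positive divisors $d$ of $n$ with $d \le n^{1/4}$. Moreover the constant $8$ is best possible: there is no real number $C<8$ such that $\tau(n) \leq C \sum_{d\mid n,\ d\leq n^{1/4}} \tau(d)^7$ holds for all integers $n\geq 1$.
   Context: $\tau(n)$ denotes the number of positive divisors of the positive integer $n$. *)

theory Defs
  imports "HOL-Number_Theory.Number_Theory"
begin

(* Intended for n \<ge> 1; every natural number divides 0, so tau 0 = 0 because card of an
   infinite set is 0. *)
definition tau :: "nat \<Rightarrow> nat" where
  "tau n = card {d. d dvd n}"

end

theory Submission
  imports Defs
begin

text \<open>
  A single divisor suffices: every \<open>n \<ge> 1\<close> has a divisor \<open>d\<close> with \<open>d\<^sup>4 \<le> n\<close> and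
  \<open>\<tau>(n) \<le> 8 \<tau>(d)\<^sup>7\<close>. Argue by strong induction; let \<open>p\<close> be the least prime factor of \<open>n\<close> and
  \<open>a\<close> its exponent. If \<open>a \<ge> 4\<close>, split off \<open>p\<^sup>a\<close> from \<open>n\<close> and put \<open>p\<close> to the power \<open>\<lfloor>a/4\<rfloor>\<close> into
  \<open>d\<close>. If \<open>a \<le> 3\<close>, split off \<open>p\<^sup>a\<close> together with \<open>4 - a\<close> further prime factors, which are all at
  least \<open>p\<close>: this divides \<open>n\<close> by at least \<open>p\<^sup>4\<close> and \<open>\<tau>(n)\<close> by at most \<open>16\<close>, so putting a single
  \<open>p\<close> into \<open>d\<close> is enough. If there are too few factors, then \<open>\<tau>(n) \<le> 8\<close> and \<open>d = 1\<close> works.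
  The constant is attained at \<open>n = 5 \<cdot> 7 \<cdot> 11\<close>, where only \<open>d = 1\<close> occurs in the sum.
\<close>

lemma tau_mult_le:
  assumes "m > 0" "n > 0"
  shows "tau (m * n) \<le> tau m * tau n"
proof -
  have fin: "finite ({d. d dvd m} \<times> {d. d dvd n})"
    using assms by simp
  have "{d. d dvd m * n} \<subseteq> (\<lambda>(a, b). a * b) ` ({d. d dvd m} \<times> {d. d dvd n})"
    by (auto dest!: division_decomp simp: image_iff)
  from surj_card_le[OF fin this] show ?thesis
    by (simp add: tau_def card_cartesian_product)
qed

text \<open>Coprimality makes the product map injective on pairs of divisors: if
  \<open>a * b = a' * b'\<close>, then \<open>a\<close> is coprime to \<open>b'\<close> and hence
  divides \<open>a'\<close>, and vice versa. This gives \<ge>; the other direction is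
  submultiplicativity.\<close>

lemma tau_mult_coprime:
  assumes "m > 0" "n > 0" "coprime m n"
  shows "tau (m * n) = tau m * tau n"
proof (rule antisym)
  let ?D = "{d. d dvd m} \<times> {d. d dvd n}"
  have "inj_on (\<lambda>(a, b). a * b) ?D"
  proof (rule inj_onI, clarsimp)
    fix a b a' b'
    assume *: "a dvd m" "b dvd n" "a' dvd m" "b' dvd n" "a * b = a' * b'"
    have "coprime a b'" "coprime a' b"
      using * assms(3) by (meson coprime_divisors)+
    then have "a dvd a'" "a' dvd a"
      using *(5) by (metis coprime_dvd_mult_left_iff dvd_triv_left)+
    then have "a = a'" by (rule dvd_antisym)
    moreover have "a > 0" using *(1) assms(1) by (auto intro: Nat.gr0I)
    ultimately show "a = a' \<and> b = b'" using *(5) by simp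
  qed
  then have "card ?D \<le> card {d. d dvd m * n}"
    using assms by (intro card_inj_on_le[of "\<lambda>(a, b). a * b"]) (auto intro: mult_dvd_mono)
  then show "tau m * tau n \<le> tau (m * n)"
    by (simp add: tau_def card_cartesian_product)
qed (use assms tau_mult_le in auto)

lemma tau_prime_power:
  assumes "prime p"
  shows "tau (p ^ k) = k + 1"
proof -
  have "{d. d dvd p ^ k} = (\<lambda>i. p ^ i) ` {..k}"
    using divides_primepow_nat[OF assms] by auto
  moreover have "inj_on (\<lambda>i. p ^ i) {..k}"
    using prime_gt_1_nat[OF assms] by (auto intro: inj_onI)
  ultimately show ?thesis by (simp add: tau_def card_image)
qed

lemma tau_prime: "prime p \<Longrightarrow> tau p = 2"
  using tau_prime_power[of p 1] by simp

lemma tau_1 [simp]: "tau (Suc 0) = 1"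
  by (simp add: tau_def)

text \<open>Prime factors are peeled off one at a time: each is at least \<open>p\<close>, and
  removing it at most halves \<open>tau\<close>. The first alternative covers running out early:
  with fewer than \<open>k\<close> prime factors, \<open>tau n \<le> 2 ^ (k - 1)\<close>.\<close>

lemma remove_large_prime_factors:
  assumes "n > 0" "\<And>q. prime q \<Longrightarrow> q dvd n \<Longrightarrow> p \<le> q"
  shows "2 * tau n \<le> 2 ^ k \<or> (\<exists>m. m dvd n \<and> p ^ k * m \<le> n \<and> tau n \<le> 2 ^ k * tau m)"
proof (induction k)
  case 0
  then show ?case by (auto intro: exI[of _ n])
next
  case (Suc k)
  then show ?case
  proof
    assume "\<exists>m. m dvd n \<and> p ^ k * m \<le> n \<and> tau n \<le> 2 ^ k * tau m"
    then obtain m where m: "m dvd n" "p ^ k * m \<le> n" "tau n \<le> 2 ^ k * tau m" by blast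
    show ?thesis
    proof (cases "m = 1")
      case False
      then obtain q where q: "prime q" "q dvd m"
        using prime_factor_nat by blast
      then obtain l where l: "m = q * l" by blast
      have "l > 0" using m(1) assms(1) l by (auto intro: Nat.gr0I)
      have "p \<le> q" using assms(2) q m(1) dvd_trans by blast
      have "p ^ Suc k * l = p ^ k * (p * l)" by simp
      also have "\<dots> \<le> p ^ k * m"
        unfolding l using \<open>p \<le> q\<close> by (intro mult_left_mono mult_right_mono) auto
      also have "\<dots> \<le> n" by (rule m(2))
      finally have "p ^ Suc k * l \<le> n" .
      moreover have "tau m \<le> 2 * tau l"
        using tau_mult_le[of q l] prime_gt_0_nat[OF q(1)] \<open>l > 0\<close> l tau_prime[OF q(1)] by simp
      then have "2 ^ k * tau m \<le> 2 ^ k * (2 * tau l)" by (rule mult_left_mono) simp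
      with m(3) have "tau n \<le> 2 ^ k * (2 * tau l)" by (rule le_trans)
      then have "tau n \<le> 2 ^ Suc k * tau l" by simp
      moreover have "l dvd n" using m(1) l by (metis dvd_mult_right)
      ultimately show ?thesis by blast
    qed (use m(3) in auto)
  qed auto
qed

lemma exists_small_divisor_tau_power:
  fixes n :: nat
  assumes "n > 0"
  shows "\<exists>d. d dvd n \<and> d ^ 4 \<le> n \<and> tau n \<le> 8 * tau d ^ 7"
  using assms
proof (induction n rule: less_induct)
  case (less n)
  show ?case
  proof (cases "tau n \<le> 8")
    case True
    then show ?thesis using less.prems by (intro exI[of _ 1]) auto
  next
    case False
    then have "n \<noteq> 1" by auto
    define p where "p = (LEAST p. prime p \<and> p dvd n)"
    have "\<exists>p. prime p \<and> p dvd n" using \<open>n \<noteq> 1\<close> prime_factor_nat by blast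
    then have p: "prime p" "p dvd n"
      unfolding p_def by (metis (mono_tags, lifting) LeastI_ex)+
    have p_least: "p \<le> q" if "prime q" "q dvd n" for q
      unfolding p_def using that by (simp add: Least_le)
    define a where "a = multiplicity p n"
    obtain m where m: "n = p ^ a * m" "\<not> p dvd m"
      unfolding a_def using multiplicity_decompose'[of n p] less.prems p(1)
      by (metis not_prime_unit not_gr0)
    have "a > 0"
      unfolding a_def using p less.prems by (simp add: prime_multiplicity_gt_zero_iff)
    have p1: "p > 1" using p(1) by (rule prime_gt_1_nat)
    have "m > 0" using m less.prems by (auto intro: Nat.gr0I)
    \<comment> \<open>Since \<open>m\<close> carries no factor \<open>p\<close>, \<open>tau\<close>
      splits exactly on \<open>p ^ i * l\<close> for every divisor \<open>l\<close> of
      \<open>m\<close>; this serves both \<open>n\<close> and the divisor being built.\<close>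
    have cop: "coprime (p ^ i) l" if "l dvd m" for i l
      using that m(2) p(1) by (meson coprime_power_left_iff dvd_trans prime_imp_coprime)
    have tau_split: "tau (p ^ i * l) = (i + 1) * tau l" if "l dvd m" for i l
      using tau_mult_coprime[of "p ^ i" l] cop[OF that] p1 that \<open>m > 0\<close> tau_prime_power[OF p(1)]
      by (simp add: dvd_pos_nat)
    have smaller: "l < n" if "l dvd m" for l
    proof -
      have "l \<le> m" using that \<open>m > 0\<close> by (simp add: dvd_imp_le)
      also have "1 < p ^ a" using p1 \<open>a > 0\<close> by (rule one_less_power)
      then have "m < n" using m(1) \<open>m > 0\<close> by simp
      finally show ?thesis .
    qed
    have tau_n: "tau n = (a + 1) * tau m" using tau_split[of m a] m(1) by simp
    show ?thesis
    proof (cases "a \<ge> 4")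
      case True
      define q where "q = a div 4"
      have q: "4 * q \<le> a" "a + 1 \<le> 4 * (q + 1)" "q \<ge> 1" unfolding q_def using True by auto
      obtain d where d: "d dvd m" "d ^ 4 \<le> m" "tau m \<le> 8 * tau d ^ 7"
        using less.IH[OF smaller[OF dvd_refl] \<open>m > 0\<close>] by blast
      have "p ^ q * d dvd n"
        using d(1) m(1) q(1) by (auto intro!: mult_dvd_mono le_imp_power_dvd)
      moreover have "(p ^ q * d) ^ 4 \<le> n"
      proof -
        have "(p ^ q * d) ^ 4 = p ^ (4 * q) * d ^ 4"
          by (simp add: power_mult_distrib power_mult[symmetric] mult.commute)
        also have "\<dots> \<le> p ^ a * m"
          using p1 q(1) d(2) by (intro mult_mono power_increasing) auto
        finally show ?thesis using m(1) by simp
      qed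
      moreover have "tau n \<le> 8 * tau (p ^ q * d) ^ 7"
      proof -
        \<comment> \<open>As \<open>q \<ge> 1\<close>, the factor 4 lost by rounding down in
          \<open>a div 4\<close> is absorbed by \<open>(q + 1) ^ 2\<close>.\<close>
        have "2 ^ 2 \<le> (q + 1) ^ 2" using q(3) by (intro power_mono) auto
        then have "a + 1 \<le> (q + 1) ^ 2 * (q + 1)"
          using q(2) mult_right_mono[of 4 "(q + 1) ^ 2" "q + 1"] by simp
        also have "\<dots> = (q + 1) ^ 3" by (simp add: eval_nat_numeral)
        also have "\<dots> \<le> (q + 1) ^ 7" by (intro power_increasing) auto
        finally have "tau n \<le> (q + 1) ^ 7 * (8 * tau d ^ 7)"
          unfolding tau_n using d(3) by (rule mult_mono) auto
        also have "\<dots> = 8 * tau (p ^ q * d) ^ 7"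
          unfolding tau_split[OF d(1)] power_mult_distrib by (rule mult.left_commute)
        finally show ?thesis .
      qed
      ultimately show ?thesis by blast
    next
      case False
      \<comment> \<open>Each of the \<open>a\<close> factors \<open>p\<close> is charged a factor 2,
        so together with \<open>4 - a\<close> further primes the total loss is
        \<open>2 ^ 4\<close>.\<close>
      have a_le: "a + 1 \<le> 2 ^ a" by (induction a) auto
      have pow: "x ^ a * x ^ (4 - a) = x ^ 4" for x :: nat
        using False by (simp add: power_add[symmetric])
      \<comment> \<open>Too few further primes would force \<open>tau n \<le> 8\<close>, a case
        already settled by \<open>d = 1\<close>.\<close>
      have "\<not> 2 * tau m \<le> 2 ^ (4 - a)"
      proof
        assume "2 * tau m \<le> 2 ^ (4 - a)"
        from mult_mono[OF a_le this] have "2 * tau n \<le> 2 ^ 4"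
          unfolding tau_n pow by simp
        with \<open>\<not> tau n \<le> 8\<close> show False by simp
      qed
      moreover have "p \<le> q" if "prime q" "q dvd m" for q
        using that p_least m(1) by simp
      ultimately obtain l where l: "l dvd m" "p ^ (4 - a) * l \<le> m" "tau m \<le> 2 ^ (4 - a) * tau l"
        using remove_large_prime_factors[OF \<open>m > 0\<close>, of p "4 - a"] by blast
      have "l > 0" using l(1) \<open>m > 0\<close> by (rule dvd_pos_nat[rotated])
      then obtain d where d: "d dvd l" "d ^ 4 \<le> l" "tau l \<le> 8 * tau d ^ 7"
        using less.IH[OF smaller[OF l(1)]] by blast
      have dm: "d dvd m" using d(1) l(1) by (rule dvd_trans)
      have "p * d dvd n"
        using dm m(1) \<open>a > 0\<close> by (auto intro!: mult_dvd_mono)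
      moreover have "(p * d) ^ 4 \<le> n"
      proof -
        have "(p * d) ^ 4 \<le> p ^ 4 * l" using d(2) by (simp add: power_mult_distrib)
        also have "\<dots> = p ^ a * (p ^ (4 - a) * l)" by (simp add: pow flip: mult.assoc)
        also have "\<dots> \<le> n" unfolding m(1) using l(2) by (rule mult_left_mono) simp
        finally show ?thesis .
      qed
      moreover have "tau n \<le> 8 * tau (p * d) ^ 7"
      proof -
        have "tau n \<le> 2 ^ a * (2 ^ (4 - a) * tau l)"
          unfolding tau_n using a_le l(3) by (rule mult_mono) auto
        also have "\<dots> = 2 ^ 4 * tau l" by (simp only: pow flip: mult.assoc)
        \<comment> \<open>Here \<open>2 ^ 7\<close> is the gain from putting the single
          \<open>p\<close> into the divisor, as \<open>p\<close> does not divide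
          \<open>d\<close>.\<close>
        also have "\<dots> \<le> 2 ^ 7 * (8 * tau d ^ 7)" using d(3) by (intro mult_mono) auto
        also have "\<dots> = 8 * tau (p * d) ^ 7"
          using tau_split[OF dm, of 1] by (simp add: power_mult_distrib flip: mult_2)
        finally show ?thesis .
      qed
      ultimately show ?thesis by blast
    qed
  qed
qed

text \<open>Links the real bound of the theorem to the integer condition used in the induction, by
  monotonicity of the fourth root.\<close>

lemma le_powr_quarter_iff:
  fixes d n :: nat
  shows "real d \<le> real n powr (1 / 4) \<longleftrightarrow> d ^ 4 \<le> n"
proof -
  have "real d \<le> real n powr (1 / 4) \<longleftrightarrow> real d \<le> root 4 (real n)"
    by (simp add: root_powr_inverse inverse_eq_divide)
  also have "\<dots> \<longleftrightarrow> real d ^ 4 \<le> real n"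
    by (metis of_nat_0_le_iff real_root_le_iff real_root_power_cancel zero_less_numeral)
  finally show ?thesis by (simp flip: of_nat_power)
qed

theorem theorem1p2:
  shows "(\<forall>n::nat. n \<ge> 1 \<longrightarrow>
            tau n \<le> 8 * (\<Sum>d | d dvd n \<and> real d \<le> real n powr (1 / 4). tau d ^ 7)) \<and>
         \<not> (\<exists>C::real. C < 8 \<and>
            (\<forall>n::nat. n \<ge> 1 \<longrightarrow>
              real (tau n) \<le>
                C * (\<Sum>d | d dvd n \<and> real d \<le> real n powr (1 / 4). real (tau d) ^ 7)))"
proof (intro conjI allI impI notI)
  fix n :: nat
  assume n: "n \<ge> 1"
  then obtain d where d: "d dvd n" "d ^ 4 \<le> n" "tau n \<le> 8 * tau d ^ 7"
    using exists_small_divisor_tau_power[of n] by auto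
  have "tau d ^ 7 \<le> (\<Sum>d | d dvd n \<and> real d \<le> real n powr (1 / 4). tau d ^ 7)"
    using n d(1,2) unfolding le_powr_quarter_iff
    by (intro member_le_sum) auto
  with d(3) show "tau n \<le> 8 * (\<Sum>d | d dvd n \<and> real d \<le> real n powr (1 / 4). tau d ^ 7)"
    by linarith
next
  assume "\<exists>C::real. C < 8 \<and>
            (\<forall>n::nat. n \<ge> 1 \<longrightarrow>
              real (tau n) \<le>
                C * (\<Sum>d | d dvd n \<and> real d \<le> real n powr (1 / 4). real (tau d) ^ 7))"
  then obtain C :: real where "C < 8" and bound: "\<And>n. n \<ge> 1 \<Longrightarrow> real (tau n) \<le>
      C * (\<Sum>d | d dvd n \<and> real d \<le> real n powr (1 / 4). real (tau d) ^ 7)"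
    by blast
  \<comment> \<open>The least prime factor of 385 is 5, and \<open>5 ^ 4 = 625\<close> already
    exceeds 385. The sum is therefore 1 while \<open>tau 385 = 8\<close>, which forces
    \<open>C \<ge> 8\<close>.\<close>
  have "{d::nat. d dvd 385 \<and> d ^ 4 \<le> 385} = {1}"
  proof (intro equalityI subsetI)
    fix d :: nat
    assume d: "d \<in> {d. d dvd 385 \<and> d ^ 4 \<le> 385}"
    have "d < 5"
    proof (rule ccontr)
      assume "\<not> d < 5"
      then have "5 ^ 4 \<le> d ^ 4" by (intro power_mono) auto
      with d show False by simp
    qed
    then have "d = 0 \<or> d = 1 \<or> d = 2 \<or> d = 3 \<or> d = 4" by linarith
    with d show "d \<in> {1}" by auto
  qed auto
  then have "(\<Sum>d | d dvd 385 \<and> real d \<le> real 385 powr (1 / 4). real (tau d) ^ 7) = 1"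
    unfolding le_powr_quarter_iff by simp
  moreover have "tau 385 = 8"
  proof -
    have primes: "prime (5::nat)" "prime (7::nat)" "prime (11::nat)" by simp_all
    then have "coprime (5::nat) 77" "coprime (7::nat) 11"
      by (simp_all add: prime_imp_coprime)
    then show ?thesis
      using tau_mult_coprime[of 5 77] tau_mult_coprime[of 7 11] primes[THEN tau_prime] by simp
  qed
  ultimately show False using bound[of 385] \<open>C < 8\<close> by simp
qed

end
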